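(* Let $p\in\{1,2,\infty\}$, let $d\ge 1$ and $\mathbf n=(n_1,\dots,n_d)$ be a tuple of positive integers, and let $k\ge 1$. Then every extreme point of $B_p$ is also an extreme point of the theta body $\mathrm{TH}_k(I_p)$.
   Context: Let $[\mathbf n]=[n_1]\times\cdots\times[n_d]$ with $[m]=\{1,\dots,m\}$. A tensor $x\in\mathbb R^{n_1\times\cdots\times n_d}$ has entries $x_a$, $a\in[\mathbf n]$, and $\mathbb R[X]$ is the polynomial ring in the variables $x_a$, $a\in[\mathbf n]$. For $a,b\in[\mathbf n]$ let $a\wedge b=(\min(a_i,b_i))_i$ and $a\vee b=(\max(a_i,b_i))_i$. Define the ideals $I_1=\langle x_a^3-x_a\ (a\in[\mathbf n]),\ x_ax_b\ (a\ne b),\ \sum_{a}x_a^2-1\rangle$, $I_2=\langle \sum_{a}x_a^2-1,\ x_ax_b-x_{a\wedge b}x_{a\vee b}\ (a,b\in[\mathbf n])\rangle$, $I_\infty=\langle x_a^2-1\ (a\in[\mathbf n]),\ x_ax_b-x_{a\wedge b}x_{a\vee b}\ (a,b\in[\mathbf n])\rangle$. The unit ball of the nuclear $p$-norm is $B_p=\mathrm{conv}\{x^{(1)}\otimes\cdots\otimes x^{(d)}: x^{(i)}\in\mathbb R^{n_i},\ \|x^{(i)}\|_p=1\}$. Theta bodies. For an ideal $I$ in $\mathbb R[X]$, the degree of a class is $\deg(f+I)=\min\{\deg h: h\equiv f \bmod I\}$; $V_j=\{f+I:\deg(f+I)\le j\}$; $\Sigma_k(I)\subset V_{2k}$ is the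 set of classes $\sum_i h_i^2+I$ of finite sums of squares of polynomials $h_i$ with $\deg h_i\le k$; $\Sigma_k(I)^*=\{\ell\in V_{2k}^*:\ell(s)\ge 0\ \forall s\in\Sigma_k(I)\}$, where $V_{2k}^*$ is the space of linear functionals on $V_{2k}$. The theta-$k$ body of $I$ is $\mathrm{TH}_k(I)=\mathrm{cl}\{(\ell(x_a+I))_{a}:\ \ell\in\Sigma_k(I)^*,\ \ell(1+I)=1\}$. *)

theory Defs
  imports
    "HOL-Analysis.Analysis"
    "HOL-Library.Function_Algebras"
    "HOL-Library.Set_Algebras"
    "HOL-Library.Poly_Mapping"
    "HOL-Library.Extended_Real"
begin

section \<open>Real-valued functions as a vector space\<close>

text \<open>
  The library provides the additive group structure and the product topology on function
  spaces, but not the pointwise scalar multiplication. It is needed for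
  \<^const>\<open>convex\<close>, \<^const>\<open>hull\<close> and \<^const>\<open>extreme_point_of\<close> on tensors.
\<close>

instantiation "fun" :: (type, real_vector) real_vector
begin

definition scaleR_fun :: "real \<Rightarrow> ('a \<Rightarrow> 'b) \<Rightarrow> 'a \<Rightarrow> 'b"
  where "scaleR_fun c f = (\<lambda>x. c *\<^sub>R f x)"

instance
  by standard (simp_all add: scaleR_fun_def fun_eq_iff scaleR_add_right scaleR_add_left)

end


section \<open>Multi-indices, tensors and the nuclear unit ball\<close>

text \<open>
  A multi-index is a function that takes the default value \<^term>\<open>undefined\<close> outside
  \<open>{1..d}\<close>. Since \<^const>\<open>inf\<close> and \<^const>\<open>sup\<close> act pointwise on functions and are idempotent,
  they restrict to the componentwise minimum and maximum on multi-indices.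
\<close>

type_synonym multi_index = "nat \<Rightarrow> nat"

definition multi_indices :: "nat \<Rightarrow> (nat \<Rightarrow> nat) \<Rightarrow> multi_index set"
  where "multi_indices d n = (\<Pi>\<^sub>E i\<in>{1..d}. {1..n i})"

lemma inf_multi_indices: "a \<in> multi_indices d n \<Longrightarrow> b \<in> multi_indices d n \<Longrightarrow> inf a b \<in> multi_indices d n"
  and sup_multi_indices: "a \<in> multi_indices d n \<Longrightarrow> b \<in> multi_indices d n \<Longrightarrow> sup a b \<in> multi_indices d n"
  by (auto simp: multi_indices_def PiE_iff extensional_def inf_min sup_max min_def max_def)

text \<open>
  Tensors in \<open>\<real>\<^bsup>n\<^sub>1 \<times> \<dots> \<times> n\<^sub>d\<^esup>\<close> are the functions on multi-indices that vanish outside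
  \<^term>\<open>multi_indices d n\<close>; the product topology induces the usual topology on them.
  A vector of \<open>\<real>\<^sup>m\<close> is a function of which only the values on \<open>{1..m}\<close> are used.
\<close>

type_synonym tensor = "multi_index \<Rightarrow> real"

definition rank_one :: "nat \<Rightarrow> (nat \<Rightarrow> nat) \<Rightarrow> (nat \<Rightarrow> nat \<Rightarrow> real) \<Rightarrow> tensor"
  where "rank_one d n x = (\<lambda>a. if a \<in> multi_indices d n then \<Prod>i=1..d. x i (a i) else 0)"

definition lp_norm :: "ereal \<Rightarrow> nat \<Rightarrow> (nat \<Rightarrow> real) \<Rightarrow> real"
  where "lp_norm p m v =
    (if p = \<infinity> then Max ((\<lambda>j. \<bar>v j\<bar>) ` {1..m})
     else (\<Sum>j=1..m. \<bar>v j\<bar> powr real_of_ereal p) powr (1 / real_of_ereal p))"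

definition nuclear_ball :: "ereal \<Rightarrow> nat \<Rightarrow> (nat \<Rightarrow> nat) \<Rightarrow> tensor set"
  where "nuclear_ball p d n =
    convex hull {rank_one d n x | x. \<forall>i\<in>{1..d}. lp_norm p (n i) (x i) = 1}"


section \<open>Multivariate polynomials and ideals\<close>

text \<open>
  A polynomial maps exponent vectors to coefficients. The ring \<open>\<real>[x\<^sub>a | a \<in> A]\<close> is the
  subring \<open>poly_ring A\<close> of the ring of polynomials in variables indexed by the whole type.
\<close>

type_synonym 'v mpoly = "('v \<Rightarrow>\<^sub>0 nat) \<Rightarrow>\<^sub>0 real"

definition poly_ring :: "'v set \<Rightarrow> 'v mpoly set"
  where "poly_ring A = {f. \<forall>m\<in>Poly_Mapping.keys f. Poly_Mapping.keys m \<subseteq> A}"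

definition var :: "'v \<Rightarrow> 'v mpoly"
  where "var a = Poly_Mapping.single (Poly_Mapping.single a 1) 1"

definition const :: "real \<Rightarrow> 'v mpoly"
  where "const c = Poly_Mapping.single 0 c"

definition monom_degree :: "('v \<Rightarrow>\<^sub>0 nat) \<Rightarrow> nat"
  where "monom_degree m = (\<Sum>a\<in>Poly_Mapping.keys m. Poly_Mapping.lookup m a)"

text \<open>The zero polynomial has degree 0.\<close>

definition total_degree :: "'v mpoly \<Rightarrow> nat"
  where "total_degree f = Max (insert 0 (monom_degree ` Poly_Mapping.keys f))"

definition ideal_generated :: "'v set \<Rightarrow> 'v mpoly set \<Rightarrow> 'v mpoly set"
  where "ideal_generated A G =
    {\<Sum>g\<in>F. q g * g | F q. finite F \<and> F \<subseteq> G \<and> (\<forall>g\<in>F. q g \<in> poly_ring A)}"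


section \<open>Theta bodies\<close>

text \<open>
  The residue class of \<open>f\<close> modulo \<open>I\<close> is the coset \<^term>\<open>f +o I\<close>; an element of the quotient
  ring is thus a set of polynomials.
\<close>

definition class_degree :: "'v mpoly set \<Rightarrow> nat"
  where "class_degree C = (LEAST j. \<exists>h\<in>C. total_degree h = j)"

definition classes_upto :: "'v set \<Rightarrow> 'v mpoly set \<Rightarrow> nat \<Rightarrow> 'v mpoly set set"
  where "classes_upto A I j = {f +o I | f. f \<in> poly_ring A \<and> class_degree (f +o I) \<le> j}"

definition sos_classes :: "'v set \<Rightarrow> 'v mpoly set \<Rightarrow> nat \<Rightarrow> 'v mpoly set set"
  where "sos_classes A I k =
    {(\<Sum>h\<leftarrow>hs. h\<^sup>2) +o I | hs. \<forall>h\<in>set hs. h \<in> poly_ring A \<and> total_degree h \<le> k}"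

text \<open>
  A linear functional on a space \<open>V\<close> of classes; its values outside \<open>V\<close> are irrelevant.
  The operations of the quotient are given on representatives.
\<close>

definition linear_functional_on :: "'v set \<Rightarrow> 'v mpoly set \<Rightarrow> 'v mpoly set set \<Rightarrow> ('v mpoly set \<Rightarrow> real) \<Rightarrow> bool"
  where "linear_functional_on A I V l \<longleftrightarrow>
    (\<forall>f\<in>poly_ring A. \<forall>g\<in>poly_ring A. f +o I \<in> V \<longrightarrow> g +o I \<in> V \<longrightarrow>
       l ((f + g) +o I) = l (f +o I) + l (g +o I)) \<and>
    (\<forall>c. \<forall>f\<in>poly_ring A. f +o I \<in> V \<longrightarrow> l ((const c * f) +o I) = c * l (f +o I))"

definition sos_dual :: "'v set \<Rightarrow> 'v mpoly set \<Rightarrow> nat \<Rightarrow> ('v mpoly set \<Rightarrow> real) set"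
  where "sos_dual A I k =
    {l. linear_functional_on A I (classes_upto A I (2 * k)) l \<and> (\<forall>s\<in>sos_classes A I k. 0 \<le> l s)}"

definition theta_body :: "'v set \<Rightarrow> 'v mpoly set \<Rightarrow> nat \<Rightarrow> ('v \<Rightarrow> real) set"
  where "theta_body A I k =
    closure {(\<lambda>a. if a \<in> A then l (var a +o I) else 0) | l. l \<in> sos_dual A I k \<and> l (1 +o I) = 1}"


section \<open>The ideals of the nuclear norms\<close>

definition sphere_poly :: "multi_index set \<Rightarrow> multi_index mpoly"
  where "sphere_poly A = (\<Sum>a\<in>A. (var a)\<^sup>2) - 1"

definition minor_polys :: "multi_index set \<Rightarrow> multi_index mpoly set"
  where "minor_polys A = {var a * var b - var (inf a b) * var (sup a b) | a b. a \<in> A \<and> b \<in> A}"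

definition ideal_1 :: "multi_index set \<Rightarrow> multi_index mpoly set"
  where "ideal_1 A = ideal_generated A
    ({var a ^ 3 - var a | a. a \<in> A} \<union> {var a * var b | a b. a \<in> A \<and> b \<in> A \<and> a \<noteq> b} \<union> {sphere_poly A})"

definition ideal_2 :: "multi_index set \<Rightarrow> multi_index mpoly set"
  where "ideal_2 A = ideal_generated A ({sphere_poly A} \<union> minor_polys A)"

definition ideal_inf :: "multi_index set \<Rightarrow> multi_index mpoly set"
  where "ideal_inf A = ideal_generated A ({(var a)\<^sup>2 - 1 | a. a \<in> A} \<union> minor_polys A)"

text \<open>Only the values \<open>p \<in> {1, 2, \<infinity>}\<close> are meaningful.\<close>

definition nuclear_ideal :: "ereal \<Rightarrow> multi_index set \<Rightarrow> multi_index mpoly set"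
  where "nuclear_ideal p = (if p = 1 then ideal_1 else if p = 2 then ideal_2 else ideal_inf)"

end

theory Submission
  imports Defs
begin

text \<open>
  For each of the three ideals there is a constant \<open>c\<close> (namely 1, 1 and the number of tensor
  entries) such that \<open>\<Sum>\<^sub>a x\<^sub>a\<^sup>2 \<equiv> c\<close> modulo the ideal. This one congruence
  determines enough of the theta body. Take a functional \<open>l\<close> that is nonnegative on squares and
  normalised, and put \<open>y\<^sub>a = l(x\<^sub>a)\<close>. Applying \<open>l\<close> to the sum of squares of linear forms
  \<open>\<Sum>\<^sub>a (x\<^sub>a - y\<^sub>a)\<^sup>2 \<equiv> c - 2 \<Sum>\<^sub>a y\<^sub>a x\<^sub>a + \<Sum>\<^sub>a y\<^sub>a\<^sup>2\<close> yields
  \<open>0 \<le> c - \<Sum>\<^sub>a y\<^sub>a\<^sup>2\<close>. Hence every theta body of order at least 1 lies in the Euclidean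
  ball of radius \<open>\<surd>c\<close> (\<open>theta_body_subset_euclidean_ball\<close>).

  A real zero \<open>v\<close> of the ideal belongs to the theta body, because evaluation at \<open>v\<close> is an
  admissible functional (\<open>real_zero_in_theta_body\<close>), and it lies on the bounding sphere, because
  the congruence can be evaluated at \<open>v\<close>. Every point of a sphere is extreme in the ball, by
  strict convexity, and therefore in each subset of the ball that contains it. So all real
  zeros of the ideal are extreme points of the theta body
  (\<open>real_zero_extreme_point_of_theta_body\<close>).

  It remains to see that the extreme points of the nuclear ball are zeros of the ideal. They
  are rank-one tensors with normalised factors, since the ball is the convex hull of these.
  For \<open>p = 2\<close> all such tensors are zeros. For \<open>p = 1\<close> the ball is the cross-polytope, whose
  extreme points are signed unit tensors. For \<open>p = \<infinity>\<close> a factor entry of absolute value below 1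
  can be perturbed in both directions inside the ball, so the factors of an extreme point are
  sign vectors.
\<close>


section \<open>Evaluation of polynomials\<close>

definition monom_value :: "('v \<Rightarrow> real) \<Rightarrow> ('v \<Rightarrow>\<^sub>0 nat) \<Rightarrow> real"
  where "monom_value v m = (\<Prod>a\<in>Poly_Mapping.keys m. v a ^ Poly_Mapping.lookup m a)"

definition poly_value :: "('v \<Rightarrow> real) \<Rightarrow> 'v mpoly \<Rightarrow> real"
  where "poly_value v f = (\<Sum>m\<in>Poly_Mapping.keys f. Poly_Mapping.lookup f m * monom_value v m)"

text \<open>
  Monomials with different supports can be compared only after their products are written
  over a common index set; the superfluous variables contribute factors \<open>v a ^ 0 = 1\<close>.
\<close>

lemma monom_value_superset:
  assumes "finite S" "Poly_Mapping.keys m \<subseteq> S"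
  shows "monom_value v m = (\<Prod>a\<in>S. v a ^ Poly_Mapping.lookup m a)"
  unfolding monom_value_def
  by (rule prod.mono_neutral_left) (use assms in \<open>auto simp: in_keys_iff\<close>)

lemma monom_value_add: "monom_value v (m + m') = monom_value v m * monom_value v m'"
proof -
  let ?S = "Poly_Mapping.keys m \<union> Poly_Mapping.keys m'"
  have "Poly_Mapping.keys (m + m') \<subseteq> ?S"
    by (rule keys_add)
  then show ?thesis
    by (simp add: monom_value_superset[of ?S] lookup_add power_add prod.distrib)
qed

lemma poly_value_superset:
  assumes "finite S" "Poly_Mapping.keys f \<subseteq> S"
  shows "poly_value v f = (\<Sum>m\<in>S. Poly_Mapping.lookup f m * monom_value v m)"
  unfolding poly_value_def
  by (rule sum.mono_neutral_left) (use assms in \<open>auto simp: in_keys_iff\<close>)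

lemma poly_value_zero [simp]: "poly_value v 0 = 0"
  by (simp add: poly_value_def)

lemma poly_value_single: "poly_value v (Poly_Mapping.single m c) = c * monom_value v m"
  by (simp add: poly_value_def)

lemma poly_value_add [simp]: "poly_value v (f + g) = poly_value v f + poly_value v g"
proof -
  let ?S = "Poly_Mapping.keys f \<union> Poly_Mapping.keys g"
  have "Poly_Mapping.keys (f + g) \<subseteq> ?S"
    by (rule keys_add)
  then show ?thesis
    by (simp add: poly_value_superset[of ?S] lookup_add distrib_right sum.distrib)
qed

lemma poly_value_uminus [simp]: "poly_value v (- f) = - poly_value v f"
  using poly_value_add[of v f "- f"] by simp

lemma poly_value_diff [simp]: "poly_value v (f - g) = poly_value v f - poly_value v g"
  using poly_value_add[of v f "- g"] by simp

lemma poly_value_sum [simp]: "poly_value v (\<Sum>i\<in>S. f i) = (\<Sum>i\<in>S. poly_value v (f i))"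
  by (induction S rule: infinite_finite_induct) simp_all

lemma sum_of_monomials:
  "f = (\<Sum>m\<in>Poly_Mapping.keys f. Poly_Mapping.single m (Poly_Mapping.lookup f m))"
  by (rule poly_mapping_eqI)
    (simp add: lookup_sum lookup_single when_def in_keys_iff)

text \<open>
  Both sides are bilinear, so this reduces to products of two monomials.
\<close>

lemma poly_value_mult [simp]: "poly_value v (f * g) = poly_value v f * poly_value v g"
proof -
  let ?s = "\<lambda>h m. Poly_Mapping.single m (Poly_Mapping.lookup h m)"
  have "f * g = (\<Sum>m\<in>Poly_Mapping.keys f. ?s f m) * (\<Sum>m\<in>Poly_Mapping.keys g. ?s g m)"
    by (simp flip: sum_of_monomials)
  then have "poly_value v (f * g) =
      (\<Sum>m\<in>Poly_Mapping.keys f. \<Sum>m'\<in>Poly_Mapping.keys g. poly_value v (?s f m * ?s g m'))"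
    by (simp add: sum_product)
  also have "\<dots> = poly_value v f * poly_value v g"
    unfolding poly_value_def[of v f] poly_value_def[of v g] sum_product
    by (simp add: mult_single poly_value_single monom_value_add ac_simps)
  finally show ?thesis .
qed

lemma poly_value_const [simp]: "poly_value v (const c) = c"
  by (simp add: const_def poly_value_single monom_value_def)

lemma poly_value_var [simp]: "poly_value v (var a) = v a"
  by (simp add: var_def poly_value_single monom_value_def)

lemma const_one: "const 1 = 1"
  by (simp add: const_def)

lemma poly_value_one [simp]: "poly_value v 1 = 1"
  by (simp flip: const_one)

lemma poly_value_power [simp]: "poly_value v (f ^ j) = poly_value v f ^ j"
  by (induction j) simp_all

lemma poly_value_sum_list_squares:
  "poly_value v (\<Sum>h\<leftarrow>hs. h\<^sup>2) = (\<Sum>h\<leftarrow>hs. (poly_value v h)\<^sup>2)"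
  by (induction hs) simp_all


section \<open>Polynomial rings, degrees and ideals\<close>

lemma poly_ring_const [simp]: "const c \<in> poly_ring A"
  by (auto simp: poly_ring_def const_def)

lemma poly_ring_one [simp]: "1 \<in> poly_ring A"
  by (simp flip: const_one)

lemma poly_ring_zero [simp]: "0 \<in> poly_ring A"
  by (simp add: poly_ring_def)

lemma poly_ring_var: "a \<in> A \<Longrightarrow> var a \<in> poly_ring A"
  by (auto simp: poly_ring_def var_def)

lemma poly_ring_add: "f \<in> poly_ring A \<Longrightarrow> g \<in> poly_ring A \<Longrightarrow> f + g \<in> poly_ring A"
  using keys_add[of f g] by (fastforce simp: poly_ring_def)

lemma poly_ring_diff: "f \<in> poly_ring A \<Longrightarrow> g \<in> poly_ring A \<Longrightarrow> f - g \<in> poly_ring A"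
  using keys_diff[of f g] by (fastforce simp: poly_ring_def)

lemma poly_ring_mult:
  assumes "f \<in> poly_ring A" "g \<in> poly_ring A"
  shows "f * g \<in> poly_ring A"
  unfolding poly_ring_def
proof clarify
  fix m a
  assume m: "m \<in> Poly_Mapping.keys (f * g)" and a: "a \<in> Poly_Mapping.keys m"
  obtain m1 m2 where "m = m1 + m2" "m1 \<in> Poly_Mapping.keys f" "m2 \<in> Poly_Mapping.keys g"
    using m keys_mult[of f g] by blast
  with a keys_add[of m1 m2] assms show "a \<in> A"
    unfolding poly_ring_def by blast
qed

lemma total_degree_le_iff: "total_degree f \<le> j \<longleftrightarrow> (\<forall>m\<in>Poly_Mapping.keys f. monom_degree m \<le> j)"
  by (auto simp: total_degree_def)

lemma total_degree_const [simp]: "total_degree (const c) = 0"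
  by (simp add: total_degree_def const_def monom_degree_def)

lemma total_degree_one [simp]: "total_degree 1 = 0"
  by (simp flip: const_one)

lemma total_degree_var: "total_degree (var a) \<le> 1"
  by (auto simp: total_degree_le_iff var_def monom_degree_def)

lemma total_degree_add: "total_degree f \<le> j \<Longrightarrow> total_degree g \<le> j \<Longrightarrow> total_degree (f + g) \<le> j"
  using keys_add[of f g] by (fastforce simp: total_degree_le_iff)

lemma total_degree_diff: "total_degree f \<le> j \<Longrightarrow> total_degree g \<le> j \<Longrightarrow> total_degree (f - g) \<le> j"
  using keys_diff[of f g] by (fastforce simp: total_degree_le_iff)

lemma total_degree_const_mult: "total_degree f \<le> j \<Longrightarrow> total_degree (const c * f) \<le> j"
  using keys_mult[of "const c" f] by (fastforce simp: total_degree_le_iff const_def split: if_splits)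

lemma const_add: "const (b + c) = const b + const c"
  by (simp add: const_def single_add)

lemma const_diff: "const (b - c) = const b - const c"
  by (simp add: const_def single_diff)

lemma const_uminus: "const (- c) = - const c"
  by (simp add: const_def single_uminus)

lemma const_mult: "const (b * c) = const b * const c"
  by (simp add: const_def mult_single)

lemma const_zero: "const 0 = 0"
  by (simp add: const_def)

lemma const_sum: "const (\<Sum>i\<in>S. c i) = (\<Sum>i\<in>S. const (c i))"
  by (induction S rule: infinite_finite_induct) (simp_all add: const_zero const_add)

lemma zero_in_ideal_generated [simp]: "0 \<in> ideal_generated A G"
  unfolding ideal_generated_def by (intro CollectI exI[of _ "{}"]) simp

lemma generator_in_ideal_generated: "g \<in> G \<Longrightarrow> g \<in> ideal_generated A G"
  unfolding ideal_generated_def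
  by (intro CollectI exI[of _ "{g}"] exI[of _ "\<lambda>_. 1"]) simp

text \<open>
  Multipliers extended by 0 outside the finite set of generators allow two members of an
  ideal to be subtracted over the union of their generator sets.
\<close>

lemma ideal_generatedE:
  assumes "f \<in> ideal_generated A G"
  obtains F q where "f = (\<Sum>g\<in>F. q g * g)" "finite F" "F \<subseteq> G" "\<And>g. q g \<in> poly_ring A"
    "\<And>g. g \<notin> F \<Longrightarrow> q g = 0"
proof -
  obtain F q where F: "f = (\<Sum>g\<in>F. q g * g)" "finite F" "F \<subseteq> G" "\<forall>g\<in>F. q g \<in> poly_ring A"
    using assms unfolding ideal_generated_def by blast
  show thesis
    by (rule that[of "\<lambda>g. if g \<in> F then q g else 0" F]) (use F in auto)
qed

lemma ideal_generated_diff: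
  assumes "f \<in> ideal_generated A G" "g \<in> ideal_generated A G"
  shows "f - g \<in> ideal_generated A G"
proof -
  obtain F q where F: "f = (\<Sum>h\<in>F. q h * h)" "finite F" "F \<subseteq> G" "\<And>h. q h \<in> poly_ring A"
    "\<And>h. h \<notin> F \<Longrightarrow> q h = 0"
    using assms(1) by (rule ideal_generatedE) blast
  obtain F' r where F': "g = (\<Sum>h\<in>F'. r h * h)" "finite F'" "F' \<subseteq> G" "\<And>h. r h \<in> poly_ring A"
    "\<And>h. h \<notin> F' \<Longrightarrow> r h = 0"
    using assms(2) by (rule ideal_generatedE) blast
  have "f = (\<Sum>h\<in>F \<union> F'. q h * h)"
    unfolding F(1) by (rule sum.mono_neutral_left) (use F F' in auto)
  moreover have "g = (\<Sum>h\<in>F \<union> F'. r h * h)"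
    unfolding F'(1) by (rule sum.mono_neutral_left) (use F F' in auto)
  ultimately have "f - g = (\<Sum>h\<in>F \<union> F'. (q h - r h) * h)"
    by (simp add: sum_subtractf left_diff_distrib)
  then show ?thesis
    unfolding ideal_generated_def
    by (intro CollectI exI[of _ "F \<union> F'"] exI[of _ "\<lambda>h. q h - r h"])
      (use F F' in \<open>auto intro: poly_ring_diff\<close>)
qed

lemma ideal_generated_add:
  assumes "f \<in> ideal_generated A G" "g \<in> ideal_generated A G"
  shows "f + g \<in> ideal_generated A G"
  using ideal_generated_diff[OF assms(1) ideal_generated_diff[OF zero_in_ideal_generated assms(2)]]
  by simp

lemma ideal_generated_sum:
  "(\<And>i. i \<in> S \<Longrightarrow> f i \<in> ideal_generated A G) \<Longrightarrow> (\<Sum>i\<in>S. f i) \<in> ideal_generated A G"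
  by (induction S rule: infinite_finite_induct) (auto intro: ideal_generated_add)

lemma coset_eq_if_diff_in_ideal:
  assumes "f - g \<in> ideal_generated A G"
  shows "f +o ideal_generated A G = g +o ideal_generated A G"
proof -
  have "h - f \<in> ideal_generated A G \<longleftrightarrow> h - g \<in> ideal_generated A G" for h
    using ideal_generated_add[of "h - f" A G "f - g"] ideal_generated_diff[of "h - g" A G "f - g"] assms
    by auto
  moreover have "h \<in> e +o ideal_generated A G \<longleftrightarrow> h - e \<in> ideal_generated A G" for h e
    by (auto simp: elt_set_plus_def intro: bexI[of _ "h - e"])
  ultimately show ?thesis
    by blast
qed

text \<open>
  The degree of a class is the least degree of a representative, so any representative bounds it.
\<close>

lemma class_in_classes_upto:
  assumes "f \<in> poly_ring A" "total_degree f \<le> j" "0 \<in> I"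
  shows "f +o I \<in> classes_upto A I j"
proof -
  have "f \<in> f +o I"
    using assms(3) by (force simp: elt_set_plus_def)
  then have "class_degree (f +o I) \<le> total_degree f"
    unfolding class_degree_def by (intro Least_le) blast
  with assms show ?thesis
    unfolding classes_upto_def by force
qed


section \<open>Theta bodies inside Euclidean balls\<close>

lemma poly_value_ideal_generated:
  assumes "\<And>g. g \<in> G \<Longrightarrow> poly_value v g = 0" "f \<in> ideal_generated A G"
  shows "poly_value v f = 0"
  using assms(2)
proof (rule ideal_generatedE)
  fix F q assume "f = (\<Sum>g\<in>F. q g * g)" "F \<subseteq> G"
  then show ?thesis
    using assms(1) by (auto intro!: sum.neutral)
qed

text \<open>
  Evaluation at a common zero of the generators is constant on residue classes, hence a
  linear functional on the quotient. It is nonnegative on sums of squares and recovers the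
  coordinates of the zero.
\<close>

lemma real_zero_in_theta_body:
  assumes zero: "\<And>g. g \<in> G \<Longrightarrow> poly_value v g = 0"
    and outside: "\<And>a. a \<notin> A \<Longrightarrow> v a = 0"
  shows "v \<in> theta_body A (ideal_generated A G) k"
proof -
  let ?I = "ideal_generated A G"
  define l where "l C = poly_value v (SOME f. f \<in> C)" for C
  have l: "l (f +o ?I) = poly_value v f" for f
  proof -
    have "(SOME h. h \<in> f +o ?I) \<in> f +o ?I"
      by (rule someI[of _ f]) (force simp: elt_set_plus_def)
    then obtain i where "i \<in> ?I" "(SOME h. h \<in> f +o ?I) = f + i"
      by (auto simp: elt_set_plus_def)
    then show ?thesis
      using poly_value_ideal_generated[OF zero, where f = i] by (simp add: l_def)
  qed
  have "l \<in> sos_dual A ?I k"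
    unfolding sos_dual_def linear_functional_on_def sos_classes_def
    by (auto simp: l poly_value_sum_list_squares intro!: sum_list_nonneg)
  moreover have "l (1 +o ?I) = 1"
    by (simp add: l)
  moreover have "v = (\<lambda>a. if a \<in> A then l (var a +o ?I) else 0)"
    using outside by (auto simp: l)
  ultimately show ?thesis
    unfolding theta_body_def by (intro subsetD[OF closure_subset]) blast
qed

text \<open>
  Linearity is available only for classes of bounded degree, so the degree bound on the partial
  sums has to be carried along in the induction that computes the value of an affine polynomial.
\<close>

lemma linear_functional_on_affine:
  fixes I :: "'v mpoly set" and b :: real and t :: "'v \<Rightarrow> real"
  assumes l: "linear_functional_on A I (classes_upto A I j) l" and "1 \<le> j" "0 \<in> I"
    and "finite F" "F \<subseteq> A"
  defines "f \<equiv> \<lambda>F. const b + (\<Sum>a\<in>F. const (t a) * var a)"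
  shows "f F \<in> poly_ring A \<and> total_degree (f F) \<le> 1 \<and>
    l (f F +o I) = b * l (1 +o I) + (\<Sum>a\<in>F. t a * l (var a +o I))"
  using \<open>finite F\<close> \<open>F \<subseteq> A\<close>
proof (induction F rule: finite_induct)
  case empty
  have "(1 :: 'v mpoly) +o I \<in> classes_upto A I j"
    using assms by (intro class_in_classes_upto) auto
  then have "l ((const b * 1) +o I) = b * l (1 +o I)"
    using l poly_ring_one unfolding linear_functional_on_def by blast
  then show ?case
    by (simp add: f_def)
next
  case (insert a F)
  have f: "f (insert a F) = f F + const (t a) * var a"
    using insert.hyps by (simp add: f_def algebra_simps)
  have IH: "f F \<in> poly_ring A" "total_degree (f F) \<le> 1"
      "l (f F +o I) = b * l (1 +o I) + (\<Sum>a\<in>F. t a * l (var a +o I))"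
    using insert by auto
  have a: "var a \<in> poly_ring A" "const (t a) * var a \<in> poly_ring A"
    using insert.prems by (auto intro: poly_ring_mult poly_ring_var)
  have deg: "total_degree (const (t a) * var a) \<le> 1"
    by (intro total_degree_const_mult total_degree_var)
  have cl: "h +o I \<in> classes_upto A I j" if "h \<in> poly_ring A" "total_degree h \<le> 1" for h
    using that assms by (intro class_in_classes_upto) auto
  have "l (f (insert a F) +o I) = l (f F +o I) + l ((const (t a) * var a) +o I)"
    unfolding f using l IH(1) a(2) cl[OF IH(1,2)] cl[OF a(2) deg]
    unfolding linear_functional_on_def by blast
  also have "l ((const (t a) * var a) +o I) = t a * l (var a +o I)"
    using l a(1) cl[OF a(1) total_degree_var] unfolding linear_functional_on_def by blast
  finally show ?case
    using IH a deg insert.hyps by (simp add: f poly_ring_add total_degree_add)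
qed

text \<open>
  Apply the functional to \<open>\<Sum>\<^sub>a (x\<^sub>a - y\<^sub>a)\<^sup>2\<close>, where \<open>y\<close> is the point that it defines. Modulo
  the ideal the quadratic part of this sum of squares is the constant \<open>c\<close>, so only the values
  on 1 and on the variables enter. The ball is closed, which takes care of the closure in the
  definition of the theta body.
\<close>

lemma theta_body_subset_euclidean_ball:
  fixes A :: "'v set"
  assumes "finite A" "1 \<le> k"
    and sphere: "(\<Sum>a\<in>A. (var a)\<^sup>2) - const c \<in> ideal_generated A G"
  shows "theta_body A (ideal_generated A G) k \<subseteq>
    {y. (\<Sum>a\<in>A. (y a)\<^sup>2) \<le> c \<and> (\<forall>a. a \<notin> A \<longrightarrow> y a = 0)}" (is "_ \<subseteq> ?B")
  unfolding theta_body_def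
proof (rule closure_minimal)
  let ?I = "ideal_generated A G"
  show "{(\<lambda>a. if a \<in> A then l (var a +o ?I) else 0) | l. l \<in> sos_dual A ?I k \<and> l (1 +o ?I) = 1} \<subseteq> ?B"
  proof clarify
    fix l assume l: "l \<in> sos_dual A ?I k" and l1: "l (1 +o ?I) = 1"
    define y where "y a = l (var a +o ?I)" for a
    obtain xs where xs: "set xs = A" "distinct xs"
      using finite_distinct_list[OF \<open>finite A\<close>] by blast
    define s where "s = (\<Sum>h\<leftarrow>map (\<lambda>a. var a - const (y a)) xs. h\<^sup>2)"
    define g where "g = const (c + (\<Sum>a\<in>A. (y a)\<^sup>2)) + (\<Sum>a\<in>A. const (- 2 * y a) * var a)"
    (* y is the point itself: centring the squares there makes the linear and the quadratic
       terms in y combine to minus the squared norm of y. *)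
    have "s +o ?I \<in> sos_classes A ?I k"
      unfolding sos_classes_def s_def
      using xs \<open>1 \<le> k\<close>
      by (intro CollectI exI[of _ "map (\<lambda>a. var a - const (y a)) xs"])
        (auto intro!: poly_ring_diff poly_ring_var total_degree_diff order_trans[OF total_degree_var])
    then have "0 \<le> l (s +o ?I)"
      using l unfolding sos_dual_def by blast
    also have "s +o ?I = g +o ?I"
    proof (rule coset_eq_if_diff_in_ideal)
      have sq: "(var a - const (y a))\<^sup>2 = (var a)\<^sup>2 + const (- 2 * y a) * var a + const ((y a)\<^sup>2)" for a
      proof -
        have lin: "const (- 2 * y a) = - const (y a) - const (y a)"
          unfolding const_diff[symmetric] const_uminus[symmetric] by simp
        have quad: "const ((y a)\<^sup>2) = const (y a) * const (y a)"
          by (simp add: power2_eq_square const_mult)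
        show ?thesis
          unfolding lin quad by (simp add: power2_eq_square algebra_simps)
      qed
      have "s = (\<Sum>a\<in>A. (var a - const (y a))\<^sup>2)"
        using xs by (simp add: s_def sum_list_distinct_conv_sum_set comp_def)
      also have "\<dots> = (\<Sum>a\<in>A. (var a)\<^sup>2) + (\<Sum>a\<in>A. const (- 2 * y a) * var a) + const (\<Sum>a\<in>A. (y a)\<^sup>2)"
        by (simp only: sq sum.distrib const_sum)
      finally have "s - g = (\<Sum>a\<in>A. (var a)\<^sup>2) - const c"
        by (simp add: g_def const_add)
      with sphere show "s - g \<in> ?I"
        by simp
    qed
    also have "l (g +o ?I) = c + (\<Sum>a\<in>A. (y a)\<^sup>2) + (\<Sum>a\<in>A. - 2 * y a * y a)"
      unfolding g_def
      using linear_functional_on_affine[of A ?I "2 * k" l A "c + (\<Sum>a\<in>A. (y a)\<^sup>2)" "\<lambda>a. - 2 * y a"]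
        l l1 assms by (simp add: sos_dual_def y_def)
    also have "\<dots> = c - (\<Sum>a\<in>A. (y a)\<^sup>2)"
    proof -
      have "(\<Sum>a\<in>A. - 2 * y a * y a) = - 2 * (\<Sum>a\<in>A. (y a)\<^sup>2)"
        unfolding sum_distrib_left by (simp add: power2_eq_square mult.assoc)
      then show ?thesis
        by simp
    qed
    finally show "(\<Sum>a\<in>A. (if a \<in> A then l (var a +o ?I) else 0)\<^sup>2) \<le> c \<and>
        (\<forall>a. a \<notin> A \<longrightarrow> (if a \<in> A then l (var a +o ?I) else 0) = 0)"
      by (simp add: y_def)
  qed
  have coord: "continuous_on UNIV (\<lambda>y :: 'v \<Rightarrow> real. y a)" for a
    by (rule continuous_on_product_coordinates)
  have "closed {y :: 'v \<Rightarrow> real. (\<Sum>a\<in>A. (y a)\<^sup>2) \<le> c}"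
    by (intro closed_Collect_le continuous_on_sum continuous_on_power coord continuous_on_const)
  moreover have "closed {y :: 'v \<Rightarrow> real. a \<notin> A \<longrightarrow> y a = 0}" for a
    by (cases "a \<in> A") (simp_all add: closed_Collect_eq[OF coord continuous_on_const])
  ultimately show "closed ?B"
    by (intro closed_Collect_conj closed_Collect_all)
qed

text \<open>
  Strict convexity of the squared Euclidean norm, in the form of the identity
  \<open>|(1 - u) y + u z|\<^sup>2 = (1 - u) |y|\<^sup>2 + u |z|\<^sup>2 - u (1 - u) |y - z|\<^sup>2\<close>. Extremality
  passes from the ball to every subset \<open>S\<close> that contains the point.
\<close>

lemma sphere_point_extreme_point_of:
  fixes v :: "'v \<Rightarrow> real"
  assumes "finite A"
    and ball: "S \<subseteq> {y. (\<Sum>a\<in>A. (y a)\<^sup>2) \<le> c \<and> (\<forall>a. a \<notin> A \<longrightarrow> y a = 0)}"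
    and v: "v \<in> S" "(\<Sum>a\<in>A. (v a)\<^sup>2) = c"
  shows "v extreme_point_of S"
  unfolding extreme_point_of_def
proof (intro conjI ballI notI)
  fix y z assume yz: "y \<in> S" "z \<in> S" and "v \<in> open_segment y z"
  then obtain u where "y \<noteq> z" and u: "0 < u" "u < 1" and vu: "v = (1 - u) *\<^sub>R y + u *\<^sub>R z"
    by (auto simp: in_segment)
  have "(v a)\<^sup>2 = (1 - u) * (y a)\<^sup>2 + u * (z a)\<^sup>2 - u * (1 - u) * (y a - z a)\<^sup>2" for a
    by (simp add: vu scaleR_fun_def power2_eq_square algebra_simps)
  then have "c = (1 - u) * (\<Sum>a\<in>A. (y a)\<^sup>2) + u * (\<Sum>a\<in>A. (z a)\<^sup>2) - u * (1 - u) * (\<Sum>a\<in>A. (y a - z a)\<^sup>2)"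
    unfolding v(2)[symmetric] by (simp add: sum.distrib sum_subtractf sum_distrib_left)
  also have "\<dots> \<le> (1 - u) * c + u * c - u * (1 - u) * (\<Sum>a\<in>A. (y a - z a)\<^sup>2)"
    using u yz ball by (intro diff_right_mono add_mono mult_left_mono) auto
  finally have "u * (1 - u) * (\<Sum>a\<in>A. (y a - z a)\<^sup>2) \<le> 0"
    by (simp add: algebra_simps)
  then have "(\<Sum>a\<in>A. (y a - z a)\<^sup>2) \<le> 0"
    using u by (simp add: mult_le_0_iff)
  then have "(\<Sum>a\<in>A. (y a - z a)\<^sup>2) = 0"
    by (intro antisym sum_nonneg) auto
  then have "y a = z a" if "a \<in> A" for a
    using \<open>finite A\<close> that by (simp add: sum_nonneg_eq_0_iff)
  moreover have "y a = z a" if "a \<notin> A" for a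
  proof -
    have "y a = 0" "z a = 0"
      using that yz ball by blast+
    then show ?thesis by simp
  qed
  ultimately have "y = z"
    by blast
  with \<open>y \<noteq> z\<close> show False ..
qed (fact v)

text \<open>
  Evaluating the sphere congruence at \<open>v\<close> puts \<open>v\<close> on the boundary of the ball that contains the
  theta body.
\<close>

lemma real_zero_extreme_point_of_theta_body:
  assumes "finite A" "1 \<le> k"
    and sphere: "(\<Sum>a\<in>A. (var a)\<^sup>2) - const c \<in> ideal_generated A G"
    and zero: "\<And>g. g \<in> G \<Longrightarrow> poly_value v g = 0"
    and outside: "\<And>a. a \<notin> A \<Longrightarrow> v a = 0"
  shows "v extreme_point_of theta_body A (ideal_generated A G) k"
proof (rule sphere_point_extreme_point_of)
  show "(\<Sum>a\<in>A. (v a)\<^sup>2) = c"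
    using poly_value_ideal_generated[OF zero sphere] by simp
  show "v \<in> theta_body A (ideal_generated A G) k"
    by (intro real_zero_in_theta_body zero outside)
  show "theta_body A (ideal_generated A G) k \<subseteq>
      {y. (\<Sum>a\<in>A. (y a)\<^sup>2) \<le> c \<and> (\<forall>a. a \<notin> A \<longrightarrow> y a = 0)}"
    by (intro theta_body_subset_euclidean_ball assms)
qed (fact assms)


section \<open>Extreme points of nuclear unit balls\<close>

lemma finite_multi_indices: "finite (multi_indices d n)"
  unfolding multi_indices_def by (intro finite_PiE) auto

lemma multi_indicesD: "a \<in> multi_indices d n \<Longrightarrow> i \<in> {1..d} \<Longrightarrow> a i \<in> {1..n i}"
  unfolding multi_indices_def by (rule PiE_mem)

lemma rank_one_outside: "a \<notin> multi_indices d n \<Longrightarrow> rank_one d n x a = 0"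
  by (simp add: rank_one_def)

text \<open>
  In each coordinate, the minimum and maximum are the same two indices in some order, so the two
  products have the same factors.
\<close>

lemma rank_one_minor:
  assumes "a \<in> multi_indices d n" "b \<in> multi_indices d n"
  shows "rank_one d n x a * rank_one d n x b = rank_one d n x (inf a b) * rank_one d n x (sup a b)"
  using assms
  by (simp add: rank_one_def inf_multi_indices sup_multi_indices flip: prod.distrib)
    (intro prod.cong refl, auto simp: inf_min sup_max min_def max_def)

lemma poly_value_minor_polys:
  assumes "g \<in> minor_polys (multi_indices d n)"
  shows "poly_value (rank_one d n x) g = 0"
  using assms rank_one_minor[of _ d n _ x] by (auto simp: minor_polys_def)


lemma sum_abs_rank_one:
  "(\<Sum>a\<in>multi_indices d n. \<bar>rank_one d n x a\<bar>) = (\<Prod>i=1..d. \<Sum>j=1..n i. \<bar>x i j\<bar>)"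
  unfolding multi_indices_def
  by (subst prod_sum_PiE) (auto simp: rank_one_def multi_indices_def abs_prod intro!: sum.cong)

lemma sum_squares_rank_one:
  "(\<Sum>a\<in>multi_indices d n. (rank_one d n x a)\<^sup>2) = (\<Prod>i=1..d. \<Sum>j=1..n i. (x i j)\<^sup>2)"
  unfolding multi_indices_def
  by (subst prod_sum_PiE) (auto simp: rank_one_def multi_indices_def prod_power_distrib intro!: sum.cong)

lemma lp_norm_1: "lp_norm 1 m v = (\<Sum>j=1..m. \<bar>v j\<bar>)"
  by (simp add: lp_norm_def sum_nonneg)

lemma lp_norm_2_eq_1_iff: "lp_norm 2 m v = 1 \<longleftrightarrow> (\<Sum>j=1..m. (v j)\<^sup>2) = 1"
proof -
  have "\<bar>t\<bar> powr 2 = t\<^sup>2" for t :: real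
    by (cases "t = 0") simp_all
  then have "lp_norm 2 m v = sqrt (\<Sum>j=1..m. (v j)\<^sup>2)"
    by (simp add: lp_norm_def powr_half_sqrt sum_nonneg)
  then show ?thesis
    by simp
qed

lemma lp_norm_infinity_eq_1_iff:
  assumes "1 \<le> m"
  shows "lp_norm \<infinity> m v = 1 \<longleftrightarrow> (\<forall>j\<in>{1..m}. \<bar>v j\<bar> \<le> 1) \<and> (\<exists>j\<in>{1..m}. \<bar>v j\<bar> = 1)"
proof -
  let ?S = "(\<lambda>j. \<bar>v j\<bar>) ` {1..m}"
  have "lp_norm \<infinity> m v = 1 \<longleftrightarrow> Max ?S = 1"
    by (simp add: lp_norm_def)
  also have "\<dots> \<longleftrightarrow> 1 \<in> ?S \<and> (\<forall>t\<in>?S. t \<le> 1)"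
    using assms by (intro Max_eq_iff) auto
  also have "1 \<in> ?S \<longleftrightarrow> (\<exists>j\<in>{1..m}. \<bar>v j\<bar> = 1)"
    unfolding image_iff by metis
  also have "(\<forall>t\<in>?S. t \<le> 1) \<longleftrightarrow> (\<forall>j\<in>{1..m}. \<bar>v j\<bar> \<le> 1)"
    by simp
  also have "(\<exists>j\<in>{1..m}. \<bar>v j\<bar> = 1) \<and> (\<forall>j\<in>{1..m}. \<bar>v j\<bar> \<le> 1) \<longleftrightarrow>
      (\<forall>j\<in>{1..m}. \<bar>v j\<bar> \<le> 1) \<and> (\<exists>j\<in>{1..m}. \<bar>v j\<bar> = 1)"
    by (rule conj_commute)
  finally show ?thesis .
qed

lemma nuclear_ball_extreme_point_rank_one:
  assumes "x extreme_point_of nuclear_ball p d n"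
  obtains y where "x = rank_one d n y" "\<And>i. i \<in> {1..d} \<Longrightarrow> lp_norm p (n i) (y i) = 1"
  using extreme_point_of_convex_hull assms unfolding nuclear_ball_def by blast

lemma sum_fun_pointwise: "(\<Sum>i\<in>S. f i) b = (\<Sum>i\<in>S. f i b)"
  by (induction S rule: infinite_finite_induct) simp_all

text \<open>For \<open>s = \<plusminus>1\<close> these are the vertices of the cross-polytope.\<close>

definition signed_unit_tensor :: "real \<Rightarrow> multi_index \<Rightarrow> tensor"
  where "signed_unit_tensor s a = (\<lambda>b. if b = a then s else 0)"

text \<open>
  A signed unit tensor is a product of unit vectors in which the first factor carries the sign;
  this is where a first factor has to exist.
\<close>

lemma signed_unit_tensor_in_nuclear_ball:
  assumes "1 \<le> d" "a \<in> multi_indices d n" "\<bar>s\<bar> = 1"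
  shows "signed_unit_tensor s a \<in> nuclear_ball 1 d n"
proof -
  define y where "y i j = (if j = a i then if i = 1 then s else 1 else 0)" for i j :: nat
  have "lp_norm 1 (n i) (y i) = 1" if "i \<in> {1..d}" for i
  proof -
    have "(\<Sum>j=1..n i. \<bar>y i j\<bar>) = (\<Sum>j=1..n i. if j = a i then 1 else 0)"
      using assms(3) by (intro sum.cong) (auto simp: y_def)
    then show ?thesis
      using multi_indicesD[OF assms(2) that] by (simp add: lp_norm_1)
  qed
  moreover have "rank_one d n y = signed_unit_tensor s a"
  proof
    fix b
    consider "b \<notin> multi_indices d n" | "b = a" | "b \<in> multi_indices d n" "b \<noteq> a"
      by blast
    then show "rank_one d n y b = signed_unit_tensor s a b"
    proof cases
      case 1
      then show ?thesis
        using assms(2) by (auto simp: rank_one_def signed_unit_tensor_def)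
    next
      case 2
      have "(\<Prod>i=1..d. y i (a i)) = s"
        using assms(1) by (simp add: y_def)
      then show ?thesis
        using assms(2) 2 by (simp add: rank_one_def signed_unit_tensor_def)
    next
      case 3
      then obtain i where "i \<in> {1..d}" "b i \<noteq> a i"
        using assms(2) PiE_ext unfolding multi_indices_def by blast
      then have "y i (b i) = 0" "i \<in> {1..d}"
        by (simp_all add: y_def)
      then have "(\<Prod>i=1..d. y i (b i)) = 0"
        by (intro prod_zero) blast+
      then show ?thesis
        using 3 by (simp add: rank_one_def signed_unit_tensor_def)
    qed
  qed
  ultimately show ?thesis
    unfolding nuclear_ball_def by (intro hull_inc CollectI exI[of _ y]) simp
qed

text \<open>
  The entries of a rank-one tensor with factors of unit 1-norm have absolute values summing to
  the product of these norms, which is 1. They are the weights that exhibit it as a convex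
  combination of signed unit tensors.
\<close>

lemma nuclear_ball_1_eq_cross_polytope:
  assumes "1 \<le> d"
  shows "nuclear_ball 1 d n = convex hull {signed_unit_tensor s a | s a. a \<in> multi_indices d n \<and> \<bar>s\<bar> = 1}"
    (is "_ = convex hull ?E")
proof
  show "convex hull ?E \<subseteq> nuclear_ball 1 d n"
    using signed_unit_tensor_in_nuclear_ball[OF assms]
    by (intro hull_minimal) (auto simp: nuclear_ball_def)
  show "nuclear_ball 1 d n \<subseteq> convex hull ?E"
    unfolding nuclear_ball_def
  proof (intro hull_minimal subsetI; (elim CollectE exE conjE)?)
    fix x y assume x: "x = rank_one d n y" and y: "\<forall>i\<in>{1..d}. lp_norm 1 (n i) (y i) = 1"
    (* not sgn, which would give the tensor 0 for vanishing entries *)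
    let ?s = "\<lambda>a. if 0 \<le> x a then 1 else - 1"
    have "(\<Sum>a\<in>multi_indices d n. \<bar>x a\<bar> *\<^sub>R signed_unit_tensor (?s a) a) \<in> convex hull ?E"
    proof (intro convex_sum finite_multi_indices convex_convex_hull)
      show "(\<Sum>a\<in>multi_indices d n. \<bar>x a\<bar>) = 1"
        using y by (simp add: x sum_abs_rank_one lp_norm_1)
      show "signed_unit_tensor (?s a) a \<in> convex hull ?E" if "a \<in> multi_indices d n" for a
        using that by (intro hull_inc CollectI exI[of _ "?s a"] exI[of _ a]) simp
    qed simp
    also have "(\<Sum>a\<in>multi_indices d n. \<bar>x a\<bar> *\<^sub>R signed_unit_tensor (?s a) a) = x"
    proof
      fix b
      have "(\<Sum>a\<in>multi_indices d n. \<bar>x a\<bar> *\<^sub>R signed_unit_tensor (?s a) a) b =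
          (\<Sum>a\<in>multi_indices d n. if b = a then \<bar>x b\<bar> * ?s b else 0)"
        unfolding sum_fun_pointwise
        by (intro sum.cong refl) (simp add: scaleR_fun_def signed_unit_tensor_def)
      also have "\<dots> = x b"
        using rank_one_outside[of b d n y] by (simp add: finite_multi_indices x)
      finally show "(\<Sum>a\<in>multi_indices d n. \<bar>x a\<bar> *\<^sub>R signed_unit_tensor (?s a) a) b = x b" .
    qed
    finally show "x \<in> convex hull ?E" .
  qed (rule convex_convex_hull)
qed

text \<open>
  If \<open>\<bar>y i j\<bar> < 1\<close>, then adding \<open>\<plusminus>e\<close> to this entry leaves the maximum norm of the factor at 1,
  since the maximum is attained elsewhere. The two resulting tensors lie in the ball and the
  given one is their midpoint. They are distinct: they differ in the entry that takes index \<open>j\<close>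
  in direction \<open>i\<close> and an index of absolute value 1 in every other direction.
\<close>

lemma nuclear_ball_infinity_extreme_point_signs:
  assumes n: "\<forall>i\<in>{1..d}. 1 \<le> n i"
    and x: "rank_one d n y extreme_point_of nuclear_ball \<infinity> d n"
    and y: "\<And>i. i \<in> {1..d} \<Longrightarrow> lp_norm \<infinity> (n i) (y i) = 1"
    and i: "i \<in> {1..d}" and j: "j \<in> {1..n i}"
  shows "\<bar>y i j\<bar> = 1"
proof (rule ccontr)
  assume "\<bar>y i j\<bar> \<noteq> 1"
  have yi: "\<forall>j\<in>{1..n l}. \<bar>y l j\<bar> \<le> 1" "\<exists>j\<in>{1..n l}. \<bar>y l j\<bar> = 1" if "l \<in> {1..d}" for l
    using y[OF that] n that by (auto simp: lp_norm_infinity_eq_1_iff)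
  define e where "e = 1 - \<bar>y i j\<bar>"
  have e: "0 < e"
    using yi[OF i] j \<open>\<bar>y i j\<bar> \<noteq> 1\<close> by (force simp: e_def)
  define z where "z t = y(i := (y i)(j := y i j + t))" for t
  have norm: "lp_norm \<infinity> (n l) (z t l) = 1" if "l \<in> {1..d}" "\<bar>t\<bar> \<le> e" for l t
  proof (cases "l = i")
    case True
    obtain j' where "j' \<in> {1..n i}" "\<bar>y i j'\<bar> = 1"
      using yi[OF i] by blast
    moreover have "j' \<noteq> j"
      using \<open>\<bar>y i j\<bar> \<noteq> 1\<close> \<open>\<bar>y i j'\<bar> = 1\<close> by blast
    moreover have "\<bar>y i j + t\<bar> \<le> 1"
      using that by (simp add: e_def)
    ultimately show ?thesis
      using yi[OF i] n i True by (auto simp: lp_norm_infinity_eq_1_iff z_def)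
  next
    case False
    then show ?thesis
      using y that by (simp add: z_def)
  qed
  then have ball: "rank_one d n (z t) \<in> nuclear_ball \<infinity> d n" if "\<bar>t\<bar> \<le> e" for t
    unfolding nuclear_ball_def using that by (intro hull_inc) blast
  have entry: "rank_one d n (z t) a = rank_one d n y a +
      (if a \<in> multi_indices d n \<and> a i = j then t * (\<Prod>l\<in>{1..d} - {i}. y l (a l)) else 0)" for t a
  proof -
    have "(\<Prod>l=1..d. z t l (a l)) = z t i (a i) * (\<Prod>l\<in>{1..d} - {i}. z t l (a l))"
      using i by (intro prod.remove) auto
    also have "(\<Prod>l\<in>{1..d} - {i}. z t l (a l)) = (\<Prod>l\<in>{1..d} - {i}. y l (a l))"
      by (intro prod.cong) (auto simp: z_def)
    finally have "(\<Prod>l=1..d. z t l (a l)) = z t i (a i) * (\<Prod>l\<in>{1..d} - {i}. y l (a l))" .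
    moreover have "(\<Prod>l=1..d. y l (a l)) = y i (a i) * (\<Prod>l\<in>{1..d} - {i}. y l (a l))"
      using i by (intro prod.remove) auto
    ultimately show ?thesis
      by (simp add: rank_one_def z_def algebra_simps)
  qed
  have "rank_one d n (z (- e)) \<noteq> rank_one d n (z e)"
  proof -
    obtain m where m: "\<And>l. l \<in> {1..d} \<Longrightarrow> m l \<in> {1..n l} \<and> \<bar>y l (m l)\<bar> = 1"
      using yi(2) by metis
    define a where "a = (\<lambda>l\<in>{1..d}. if l = i then j else m l)"
    have "a \<in> multi_indices d n"
      using m j by (auto simp: a_def multi_indices_def)
    moreover have "a i = j"
      using i by (simp add: a_def)
    moreover have "\<bar>\<Prod>l\<in>{1..d} - {i}. y l (a l)\<bar> = 1"
      unfolding abs_prod using m by (intro prod.neutral) (auto simp: a_def)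
    ultimately have "rank_one d n (z (- e)) a \<noteq> rank_one d n (z e) a"
      using e by (auto simp add: entry simp del: prod_zero_iff)
    then show ?thesis
      by metis
  qed
  moreover have "rank_one d n y = (1 - 1 / 2) *\<^sub>R rank_one d n (z (- e)) + (1 / 2) *\<^sub>R rank_one d n (z e)"
    by (auto simp: fun_eq_iff scaleR_fun_def entry field_simps)
  ultimately have "rank_one d n y \<in> open_segment (rank_one d n (z (- e))) (rank_one d n (z e))"
    unfolding in_segment by (intro conjI exI[of _ "1 / 2"]) auto
  moreover have "rank_one d n (z (- e)) \<in> nuclear_ball \<infinity> d n" "rank_one d n (z e) \<in> nuclear_ball \<infinity> d n"
    using ball e by auto
  ultimately show False
    using x unfolding extreme_point_of_def by blast
qed


section \<open>Extreme points of theta bodies\<close>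

lemma extreme_point_of_theta_body_1:
  assumes "1 \<le> d" "1 \<le> k" and x: "x extreme_point_of nuclear_ball 1 d n"
  shows "x extreme_point_of theta_body (multi_indices d n) (ideal_1 (multi_indices d n)) k"
proof -
  let ?A = "multi_indices d n"
  obtain s a where a: "a \<in> ?A" and s: "\<bar>s\<bar> = 1" and x: "x = signed_unit_tensor s a"
    using x extreme_point_of_convex_hull unfolding nuclear_ball_1_eq_cross_polytope[OF \<open>1 \<le> d\<close>] by blast
  have s2: "s\<^sup>2 = 1" "s ^ 3 = s"
    using s by (auto simp: abs_if power3_eq_cube split: if_splits)
  show ?thesis
    unfolding ideal_1_def
  proof (rule real_zero_extreme_point_of_theta_body[where c = 1])
    show "(\<Sum>a\<in>?A. (var a)\<^sup>2) - const 1 \<in> ideal_generated ?A ({var a ^ 3 - var a | a. a \<in> ?A} \<union>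
        {var a * var b | a b. a \<in> ?A \<and> b \<in> ?A \<and> a \<noteq> b} \<union> {sphere_poly ?A})"
      by (intro generator_in_ideal_generated) (simp add: sphere_poly_def const_one)
    have "(\<Sum>b\<in>?A. (x b)\<^sup>2) = 1"
      using a s2 by (simp add: x signed_unit_tensor_def if_distrib[of "\<lambda>t. t\<^sup>2"] finite_multi_indices cong: if_cong)
    then show "poly_value x g = 0" if "g \<in> {var a ^ 3 - var a | a. a \<in> ?A} \<union>
        {var a * var b | a b. a \<in> ?A \<and> b \<in> ?A \<and> a \<noteq> b} \<union> {sphere_poly ?A}" for g
      using that s2 by (auto simp: sphere_poly_def) (auto simp: x signed_unit_tensor_def)
  qed (use assms finite_multi_indices a in \<open>auto simp: x signed_unit_tensor_def\<close>)
qed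

lemma extreme_point_of_theta_body_2:
  assumes "1 \<le> k" and x: "x extreme_point_of nuclear_ball 2 d n"
  shows "x extreme_point_of theta_body (multi_indices d n) (ideal_2 (multi_indices d n)) k"
proof -
  let ?A = "multi_indices d n"
  obtain y where x: "x = rank_one d n y" and y: "\<And>i. i \<in> {1..d} \<Longrightarrow> lp_norm 2 (n i) (y i) = 1"
    using x by (rule nuclear_ball_extreme_point_rank_one) blast
  show ?thesis
    unfolding ideal_2_def
  proof (rule real_zero_extreme_point_of_theta_body[where c = 1])
    show "(\<Sum>a\<in>?A. (var a)\<^sup>2) - const 1 \<in> ideal_generated ?A ({sphere_poly ?A} \<union> minor_polys ?A)"
      by (intro generator_in_ideal_generated) (simp add: sphere_poly_def const_one)
    have "(\<Sum>j=1..n i. (y i j)\<^sup>2) = 1" if "i \<in> {1..d}" for i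
      using y[OF that] by (simp only: lp_norm_2_eq_1_iff)
    then have "(\<Sum>a\<in>?A. (x a)\<^sup>2) = 1"
      by (simp add: x sum_squares_rank_one)
    then show "poly_value x g = 0" if "g \<in> {sphere_poly ?A} \<union> minor_polys ?A" for g
      using that poly_value_minor_polys[of g d n y] by (auto simp: x sphere_poly_def)
  qed (use assms finite_multi_indices in \<open>auto simp: x rank_one_outside\<close>)
qed

lemma extreme_point_of_theta_body_infinity:
  assumes "1 \<le> k" and n: "\<forall>i\<in>{1..d}. 1 \<le> n i" and x: "x extreme_point_of nuclear_ball \<infinity> d n"
  shows "x extreme_point_of theta_body (multi_indices d n) (ideal_inf (multi_indices d n)) k"
proof -
  let ?A = "multi_indices d n"
  let ?G = "{(var a)\<^sup>2 - 1 | a. a \<in> ?A} \<union> minor_polys ?A"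
  obtain y where xy: "x = rank_one d n y" and y: "\<And>i. i \<in> {1..d} \<Longrightarrow> lp_norm \<infinity> (n i) (y i) = 1"
    using x by (rule nuclear_ball_extreme_point_rank_one) blast
  have sign: "\<bar>y i j\<bar> = 1" if "i \<in> {1..d}" "j \<in> {1..n i}" for i j
    using nuclear_ball_infinity_extreme_point_signs[OF n _ y that] x xy by blast
  show ?thesis
    unfolding ideal_inf_def
  proof (rule real_zero_extreme_point_of_theta_body[where c = "real (card ?A)"])
    have "(\<Sum>a\<in>?A. (var a)\<^sup>2 - 1) \<in> ideal_generated ?A ?G"
      by (intro ideal_generated_sum generator_in_ideal_generated) blast
    moreover have "(const (real (card ?A)) :: multi_index mpoly) = (\<Sum>a\<in>?A. 1)"
      using const_sum[of "\<lambda>_. 1" ?A] by (simp add: const_one)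
    ultimately show "(\<Sum>a\<in>?A. (var a)\<^sup>2) - const (real (card ?A)) \<in> ideal_generated ?A ?G"
      by (simp only: sum_subtractf)
    have "\<bar>x a\<bar> = 1" if "a \<in> ?A" for a
      using that sign multi_indicesD[OF that] by (auto simp: xy rank_one_def abs_prod intro!: prod.neutral)
    then have "(x a)\<^sup>2 = 1" if "a \<in> ?A" for a
      using that by (simp add: power2_eq_1_iff abs_eq_iff')
    then show "poly_value x g = 0" if "g \<in> ?G" for g
      using that poly_value_minor_polys[of g d n y] by (auto simp: xy)
  qed (use assms finite_multi_indices in \<open>auto simp: xy rank_one_outside\<close>)
qed

theorem theorem2:
  fixes p :: ereal and d k :: nat and n :: "nat \<Rightarrow> nat" and x :: tensor
  assumes "p \<in> {1, 2, \<infinity>}"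
    and "d \<ge> 1"
    and "\<forall>i\<in>{1..d}. n i \<ge> 1"
    and "k \<ge> 1"
    and "x extreme_point_of nuclear_ball p d n"
  shows "x extreme_point_of
    theta_body (multi_indices d n) (nuclear_ideal p (multi_indices d n)) k"
proof -
  consider "p = 1" | "p = 2" | "p = \<infinity>"
    using assms(1) by blast
  then show ?thesis
  proof cases
    case 1
    then have "nuclear_ideal p = ideal_1"
      by (simp add: nuclear_ideal_def)
    then show ?thesis
      using assms 1 extreme_point_of_theta_body_1 by metis
  next
    case 2
    then have "nuclear_ideal p = ideal_2"
      by (simp add: nuclear_ideal_def)
    then show ?thesis
      using assms 2 extreme_point_of_theta_body_2 by metis
  next
    case 3
    then have "nuclear_ideal p = ideal_inf"
      by (simp add: nuclear_ideal_def)
    then show ?thesis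
      using assms 3 extreme_point_of_theta_body_infinity by metis
  qed
qed

end
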